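(* Let $H$ be a real Hilbert space, let $p_1,\dots,p_k\in H$ be unit vectors, and let $V:H\to\mathbb{R}$ be given by $V(x)=\max_{i\in\{1,\dots,k\}}\langle p_i,x\rangle$. Let $S$ be a nonempty bounded convex subset of $H$, let $\varphi:S\multimap S$ be a multivalued map and let $c>0$ be such that $V$ is a Lapunov type function for $\varphi$ with the constant $c$. If a sequence $(\bar{x}_n)_{n=1}^\infty$ satisfies $$\bar{x}_1=x_1\in S,\qquad \bar{x}_{n+1}=\frac{n\bar{x}_n+x_{n+1}}{n+1},\qquad x_{n+1}\in\varphi(\bar{x}_n)\qquad(n\ge 1),$$ then for every $c_1>c$ there exists $N$ such that $\bar{x}_n\in\Delta_{c_1}$ for all $n\geq N$.
   Context: Notation: $V_i(x)=\langle p_i,x\rangle$ for $i=1,\dots,k$, and for a real number $c$, $\Delta_c=\{x\in H: V(x)<c\}$. A multivalued map $\varphi:S\multimap S$ assigns to each $x\in S$ a subset $\varphi(x)\subset S$. Definition: $V$ is a Lapunov type function for $\varphi$ with the constant $c>0$ if there exists $\delta$ with $0<\delta<c$ such that for all $x\in S\setminus\Delta_c$, all $i\in\{1,\dots,k\}$ and all $\omega\in\varphi(x)$: if $V_i(x)\geq V(x)-\delta$, then $V_i(\omega)\leq 0$. *)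

theory Defs
  imports "HOL-Analysis.Analysis"
begin

(* A real Hilbert space is a type of sort {real_inner, complete_space}.
   The vectors p_1, ..., p_k are the values of p :: nat => 'a on {1..k};
   maxfun is meant for k >= 1 only, since Max {} is unspecified. *)

definition maxfun :: "nat \<Rightarrow> (nat \<Rightarrow> 'a::real_inner) \<Rightarrow> 'a \<Rightarrow> real" where
  "maxfun k p x = Max ((\<lambda>i. p i \<bullet> x) ` {1..k})"

definition Delta :: "nat \<Rightarrow> (nat \<Rightarrow> 'a::real_inner) \<Rightarrow> real \<Rightarrow> 'a set" where
  "Delta k p c = {x. maxfun k p x < c}"

(* A multivalued map from S to S is a set-valued function whose values outside S
   are irrelevant; values on S may be empty. *)

definition multimap_on :: "'a set \<Rightarrow> ('a \<Rightarrow> 'a set) \<Rightarrow> bool" where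
  "multimap_on S \<phi> \<longleftrightarrow> (\<forall>x\<in>S. \<phi> x \<subseteq> S)"

definition lapunov_type ::
  "nat \<Rightarrow> (nat \<Rightarrow> 'a::real_inner) \<Rightarrow> 'a set \<Rightarrow> ('a \<Rightarrow> 'a set) \<Rightarrow> real \<Rightarrow> bool" where
  "lapunov_type k p S \<phi> c \<longleftrightarrow> c > 0 \<and>
    (\<exists>\<delta>. 0 < \<delta> \<and> \<delta> < c \<and>
      (\<forall>x \<in> S - Delta k p c. \<forall>i \<in> {1..k}. \<forall>\<omega> \<in> \<phi> x.
        p i \<bullet> x \<ge> maxfun k p x - \<delta> \<longrightarrow> p i \<bullet> \<omega> \<le> 0))"

end

theory Submission
  imports Defs
begin

text \<open>
  Write \<open>a n = V (xbar n)\<close> and let \<open>B\<close> bound the norm on \<open>S\<close>. If \<open>a n \<ge> c\<close>, then the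
  functionals that are nearly maximal at \<open>xbar n\<close> are nonpositive at \<open>x (n + 1)\<close>, and the others,
  being below \<open>a n\<close> by \<open>\<delta>\<close>, cannot catch up once \<open>n \<delta> \<ge> B\<close>; hence \<open>(n + 1) a (n + 1) \<le> n a n\<close>.
  This decay forces \<open>a n < c\<close> for arbitrarily late \<open>n\<close>. From below \<open>c\<close>, a step reaches at most
  \<open>c + B / (n + 1)\<close>, so the sequence afterwards stays below \<open>c\<^sub>1\<close>.
\<close>

lemma maxfun_ge:
  assumes "i \<in> {1..k}"
  shows "p i \<bullet> x \<le> maxfun k p x"
  using assms unfolding maxfun_def by (intro Max_ge) auto

lemma maxfun_le_iff:
  assumes "k \<ge> 1"
  shows "maxfun k p x \<le> b \<longleftrightarrow> (\<forall>i\<in>{1..k}. p i \<bullet> x \<le> b)"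
  using assms unfolding maxfun_def by (subst Max_le_iff) auto

text \<open>If \<open>a n\<close> stayed at or above \<open>c\<close> from \<open>N\<close> on,
  \<open>n * a n\<close> would be nonincreasing and yet at least \<open>n * c\<close>, which is
  unbounded. So some late \<open>a m\<close> is below \<open>c\<close>, and from there
  \<open>a n < c\<^sub>1\<close> is invariant: below \<open>c\<close> by \<open>jump\<close>, and
  above it because \<open>decay\<close> lets no value increase.\<close>

lemma eventually_below_threshold:
  fixes a :: "nat \<Rightarrow> real"
  assumes "0 < c" and "c < c\<^sub>1"
    and decay: "\<And>n. N \<le> n \<Longrightarrow> c \<le> a n \<Longrightarrow> (real n + 1) * a (n + 1) \<le> real n * a n"
    and jump: "\<And>n. N \<le> n \<Longrightarrow> a n < c \<Longrightarrow> a (n + 1) < c\<^sub>1"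
  shows "\<exists>M. \<forall>n\<ge>M. a n < c\<^sub>1"
proof -
  obtain m where m: "N \<le> m" "a m < c"
  proof (rule ccontr)
    assume "\<not> thesis"
    with that have ge: "c \<le> a n" if "N \<le> n" for n
      using \<open>N \<le> n\<close> by (meson not_le)
    have bound: "real n * a n \<le> real N * a N" if "N \<le> n" for n
      using that
    proof (induction n rule: dec_induct)
      case (step n)
      then show ?case
        using decay[of n] ge[of n] by (simp add: add.commute)
    qed simp
    obtain n where n: "real N * a N < real n * c"
      using reals_Archimedean3[OF \<open>0 < c\<close>] by blast
    \<comment> \<open>The Archimedean \<open>n\<close> may lie before \<open>N\<close>, where
      \<open>ge\<close> and \<open>bound\<close> say nothing; hence the maximum.\<close>
    have "real n * c \<le> real (max N n) * a (max N n)"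
      using ge[of "max N n"] \<open>0 < c\<close> by (intro mult_mono) auto
    then show False
      using bound[OF max.cobounded1, of n] n by linarith
  qed
  have "a n < c\<^sub>1" if "m \<le> n" for n
    using that
  proof (induction n rule: dec_induct)
    case base
    then show ?case using m \<open>c < c\<^sub>1\<close> by simp
  next
    case (step n)
    show ?case
    proof (cases "a n < c")
      case True
      then show ?thesis using jump[of n] m step by simp
    next
      case False
      then have "(real n + 1) * a (n + 1) \<le> real n * a n"
        using decay[of n] m step by simp
      \<comment> \<open>Here \<open>a n\<close> is at least \<open>c\<close>, hence positive, so
        raising the factor only enlarges the product.\<close>
      also have "\<dots> \<le> (real n + 1) * a n"
        using False \<open>0 < c\<close> by (intro mult_right_mono) auto
      finally have "a (n + 1) \<le> a n" by simp
      then show ?thesis using step by simp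
    qed
  qed
  then show ?thesis by blast
qed

theorem proposition2p10:
  fixes p :: "nat \<Rightarrow> 'a::{real_inner, complete_space}"
    and k :: nat
    and S :: "'a set"
    and \<phi> :: "'a \<Rightarrow> 'a set"
    and c :: real
    and x xbar :: "nat \<Rightarrow> 'a"
  assumes "k \<ge> 1"
    and "\<And>i. i \<in> {1..k} \<Longrightarrow> norm (p i) = 1"
    and "S \<noteq> {}" and "bounded S" and "convex S"
    and "multimap_on S \<phi>"
    and "c > 0"
    and "lapunov_type k p S \<phi> c"
    and "xbar 1 = x 1" and "x 1 \<in> S"
    and "\<And>n. n \<ge> 1 \<Longrightarrow>
      xbar (n + 1) = (1 / (real n + 1)) *\<^sub>R (real n *\<^sub>R xbar n + x (n + 1))"
    and "\<And>n. n \<ge> 1 \<Longrightarrow> x (n + 1) \<in> \<phi> (xbar n)"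
  shows "\<forall>c\<^sub>1 > c. \<exists>N. \<forall>n \<ge> N. n \<ge> 1 \<longrightarrow> xbar n \<in> Delta k p c\<^sub>1"
proof (intro allI impI)
  fix c\<^sub>1 assume "c < c\<^sub>1"
  obtain \<delta> where "0 < \<delta>" and lap: "\<And>y i \<omega>. y \<in> S \<Longrightarrow> c \<le> maxfun k p y \<Longrightarrow> i \<in> {1..k} \<Longrightarrow>
      \<omega> \<in> \<phi> y \<Longrightarrow> maxfun k p y - \<delta> \<le> p i \<bullet> y \<Longrightarrow> p i \<bullet> \<omega> \<le> 0"
    using \<open>lapunov_type k p S \<phi> c\<close> unfolding lapunov_type_def Delta_def by force
  obtain B where "0 < B" and B: "\<And>y. y \<in> S \<Longrightarrow> norm y \<le> B"
    using \<open>bounded S\<close> unfolding bounded_pos by blast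
  have pB: "p i \<bullet> y \<le> B" if "i \<in> {1..k}" "y \<in> S" for i y
    using norm_cauchy_schwarz[of "p i" y] B[OF that(2)] assms(2)[OF that(1)] by simp
  \<comment> \<open>Membership of \<open>xbar n\<close> stays a premise because this fact feeds the
    induction that proves \<open>xbar_in\<close>.\<close>
  have next_in: "x (n + 1) \<in> S" if "n \<ge> 1" "xbar n \<in> S" for n
    using that assms(12) \<open>multimap_on S \<phi>\<close> unfolding multimap_on_def by blast
  have xbar_in: "xbar n \<in> S" if "n \<ge> 1" for n
    using that
  proof (induction n rule: dec_induct)
    case base
    then show ?case using assms(9,10) by simp
  next
    case (step n)
    have "(real n / (real n + 1)) *\<^sub>R xbar n + (1 / (real n + 1)) *\<^sub>R x (n + 1) \<in> S"
      using step next_in[of n] by (intro convexD[OF \<open>convex S\<close>]) (auto simp: field_simps)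
    then show ?case
      using assms(11)[of n] step by (simp add: scaleR_add_right)
  qed
  have inner_step: "(real n + 1) * (p i \<bullet> xbar (n + 1)) = real n * (p i \<bullet> xbar n) + p i \<bullet> x (n + 1)"
    if "n \<ge> 1" for n i
    using assms(11)[OF that] by (simp add: inner_add_right)
  \<comment> \<open>Past \<open>N\<^sub>1\<close>, a gap of \<delta> scaled by \<open>n\<close>
    exceeds anything one new point can add; past \<open>N\<^sub>2\<close>, the overshoot
    \<open>B / (n + 1)\<close> is less than \<open>c\<^sub>1 - c\<close>.\<close>
  obtain N\<^sub>1 where N1: "B < real N\<^sub>1 * \<delta>"
    using reals_Archimedean3[OF \<open>0 < \<delta>\<close>] by blast
  obtain N\<^sub>2 where N2: "B < real N\<^sub>2 * (c\<^sub>1 - c)"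
    using reals_Archimedean3[of "c\<^sub>1 - c"] \<open>c < c\<^sub>1\<close> by auto
  define N where "N = max 1 (max N\<^sub>1 N\<^sub>2)"
  define a where "a n = maxfun k p (xbar n)" for n
  \<comment> \<open>Clearing the denominator turns averaging into adding one term, so the maximum
    can be bounded one functional at a time.\<close>
  have a_step: "(real n + 1) * a (n + 1) \<le> b"
    if "n \<ge> 1" and "\<And>i. i \<in> {1..k} \<Longrightarrow> real n * (p i \<bullet> xbar n) + p i \<bullet> x (n + 1) \<le> b" for n b
  proof -
    have "a (n + 1) \<le> b / (real n + 1)"
      unfolding a_def maxfun_le_iff[OF \<open>k \<ge> 1\<close>]
      using that inner_step[of n] by (auto simp: pos_le_divide_eq mult.commute)
    then show ?thesis by (simp add: field_simps)
  qed
  have le_a: "p i \<bullet> xbar n \<le> a n" if "i \<in> {1..k}" for i n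
    unfolding a_def by (rule maxfun_ge[OF that])
  have "\<exists>M. \<forall>n\<ge>M. a n < c\<^sub>1"
  proof (rule eventually_below_threshold[OF \<open>c > 0\<close> \<open>c < c\<^sub>1\<close>])
    fix n assume "N \<le> n" and ge: "c \<le> a n"
    then have n: "n \<ge> 1" "N\<^sub>1 \<le> n" by (auto simp: N_def)
    show "(real n + 1) * a (n + 1) \<le> real n * a n"
    proof (rule a_step[OF n(1)])
      fix i assume i: "i \<in> {1..k}"
      show "real n * (p i \<bullet> xbar n) + p i \<bullet> x (n + 1) \<le> real n * a n"
      proof (cases "a n - \<delta> \<le> p i \<bullet> xbar n")
        case True
        then have "p i \<bullet> x (n + 1) \<le> 0"
          using lap xbar_in[OF n(1)] ge i assms(12)[OF n(1)] unfolding a_def by blast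
        moreover have "real n * (p i \<bullet> xbar n) \<le> real n * a n"
          using le_a[OF i] by (intro mult_left_mono) auto
        ultimately show ?thesis by simp
      next
        case False
        \<comment> \<open>The scaled deficit of this functional exceeds \<open>n * \<delta>\<close>,
          which is more than \<open>B\<close>, so even a gain of \<open>B\<close> leaves it below
          \<open>n * a n\<close>.\<close>
        then have "real n * (p i \<bullet> xbar n) \<le> real n * (a n - \<delta>)"
          by (intro mult_left_mono) auto
        moreover have "real N\<^sub>1 * \<delta> \<le> real n * \<delta>"
          using n \<open>0 < \<delta>\<close> by simp
        moreover have "p i \<bullet> x (n + 1) \<le> B"
          using pB[OF i] next_in xbar_in n by blast
        ultimately show ?thesis
          using N1 by (simp add: right_diff_distrib)
      qed
    qed
  next
    fix n assume "N \<le> n" and less: "a n < c"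
    then have n: "n \<ge> 1" "N\<^sub>2 \<le> n" by (auto simp: N_def)
    have "(real n + 1) * a (n + 1) \<le> real n * c + B"
    proof (rule a_step[OF n(1)])
      fix i assume i: "i \<in> {1..k}"
      have "real n * (p i \<bullet> xbar n) \<le> real n * c"
        using le_a[OF i, of n] less by (intro mult_left_mono) auto
      moreover have "p i \<bullet> x (n + 1) \<le> B"
        using pB[OF i] next_in xbar_in n by blast
      ultimately show "real n * (p i \<bullet> xbar n) + p i \<bullet> x (n + 1) \<le> real n * c + B"
        by simp
    qed
    \<comment> \<open>The right side minus the left is
      \<open>n * (c\<^sub>1 - c) - B + c\<^sub>1\<close>, positive by the choice of
      \<open>N\<^sub>2\<close> and since \<open>c\<^sub>1 > 0\<close>.\<close>
    also have "\<dots> < (real n + 1) * c\<^sub>1"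
    proof -
      have "real N\<^sub>2 * (c\<^sub>1 - c) \<le> real n * (c\<^sub>1 - c)"
        using n \<open>c < c\<^sub>1\<close> by simp
      then show ?thesis
        using N2 \<open>c > 0\<close> \<open>c < c\<^sub>1\<close> by (simp add: algebra_simps)
    qed
    finally show "a (n + 1) < c\<^sub>1" by simp
  qed
  then show "\<exists>N. \<forall>n\<ge>N. n \<ge> 1 \<longrightarrow> xbar n \<in> Delta k p c\<^sub>1"
    unfolding a_def Delta_def by blast
qed

end
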